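(* Let $\sigma>0$ and $P\ge0$. For the vector Witsenhausen problem (the case $R=0$, in which there is no message) with input power $P$, $$\mathrm{MMSE}(P,0)\;\ge\;L(P):=\inf_{\sigma_{XV}\in[-\sigma\sqrt{P},\,\sigma\sqrt{P}]}\ \sup_{\gamma\in\mathbb{R}\setminus\{0\}}\ \frac{1}{\gamma^2}\left(\left(\sqrt{\frac{\sigma^2}{1+\sigma^2+P+2\sigma_{XV}}}-\sqrt{(1-\gamma)^2\sigma^2+\gamma^2P-2\gamma(1-\gamma)\sigma_{XV}}\right)^+\right)^2.$$ Further, the bound holds for all $m$ and not just asymptotically: for every $m\ge1$ and every encoder/decoder pair $(\mathcal{E}_m,\mathcal{D}_m)$ satisfying the power constraint $P$, $\mathbb{E}[d(\mathbf{X}_1^m,\widehat{\mathbf{X}}_1^m)]\ge L(P)$.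
   Context: Problem setting ($R=0$). For each blocklength $m$, the host signal is $\mathbf{X}_0^m\sim\mathcal{N}(0,\sigma^2\mathbb{I})$ in $\mathbb{R}^m$. An encoder $\mathcal{E}_m$ maps $\mathbf{X}_0^m$ to $\mathbf{X}_1^m=\mathbf{X}_0^m+\mathbf{V}^m\in\mathbb{R}^m$, subject to $\mathbb{E}[\|\mathbf{X}_0^m-\mathbf{X}_1^m\|^2]\le mP$. The channel outputs $\mathbf{Y}^m=\mathbf{X}_1^m+\mathbf{Z}^m$, where $\mathbf{Z}^m\sim\mathcal{N}(0,\mathbb{I})$ is independent of $\mathbf{X}_0^m$. A decoder $\mathcal{D}_m$ maps $\mathbf{Y}^m$ to an estimate $\widehat{\mathbf{X}}_1^m$ of $\mathbf{X}_1^m$. Distortion: $d(\mathbf{x}^m,\mathbf{y}^m)=\frac1m\|\mathbf{x}^m-\mathbf{y}^m\|^2$. Define $$\mathrm{MMSE}(P,0)=\inf\ \limsup_{m\to\infty}\ \mathbb{E}[d(\mathbf{X}_1^m,\widehat{\mathbf{X}}_1^m)],$$ the infimum being over all sequences $\{\mathcal{E}_m,\mathcal{D}_m\}_{m\ge1}$ satisfying the power constraint $P$. Notation: $(a)^+=\max\{a,0\}$. *)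

theory Defs
  imports "HOL-Probability.Probability"
begin

text \<open>
  The dimension \<open>m\<close> varies along a sequence of codes, so vectors in \<open>\<real>\<^sup>m\<close> are
  represented as functions on the index set \<open>{..<m}\<close>, i.e. as elements of a finite product space.
\<close>

abbreviation vec_borel :: "nat \<Rightarrow> (nat \<Rightarrow> real) measure" where
  "vec_borel m \<equiv> Pi\<^sub>M {..<m} (\<lambda>_. borel)"

text \<open>The law \<open>N(0, s\<^sup>2 I)\<close> on \<open>\<real>\<^sup>m\<close>; the parameter \<open>s\<close> is the standard deviation.\<close>

definition gaussian_vec :: "nat \<Rightarrow> real \<Rightarrow> (nat \<Rightarrow> real) measure" where
  "gaussian_vec m s = Pi\<^sub>M {..<m} (\<lambda>_. density lborel (\<lambda>x. ennreal (normal_density 0 s x)))"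

definition vec_add :: "nat \<Rightarrow> (nat \<Rightarrow> real) \<Rightarrow> (nat \<Rightarrow> real) \<Rightarrow> (nat \<Rightarrow> real)" where
  "vec_add m x y = (\<lambda>i\<in>{..<m}. x i + y i)"

definition sq_dist :: "nat \<Rightarrow> (nat \<Rightarrow> real) \<Rightarrow> (nat \<Rightarrow> real) \<Rightarrow> real" where
  "sq_dist m x y = (\<Sum>i<m. (x i - y i)\<^sup>2)"

definition distortion :: "nat \<Rightarrow> (nat \<Rightarrow> real) \<Rightarrow> (nat \<Rightarrow> real) \<Rightarrow> real" where
  "distortion m x y = sq_dist m x y / real m"

text \<open>
  Expectations of nonnegative quantities are Lebesgue integrals with values in \<open>[0, \<infinity>]\<close>, so that
  non-integrable powers and distortions count as infinite.
\<close>

definition power_constraint :: "real \<Rightarrow> real \<Rightarrow> nat \<Rightarrow> ((nat \<Rightarrow> real) \<Rightarrow> (nat \<Rightarrow> real)) \<Rightarrow> bool" where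
  "power_constraint \<sigma> P m enc \<longleftrightarrow>
     (\<integral>\<^sup>+ x0. ennreal (sq_dist m x0 (enc x0)) \<partial>gaussian_vec m \<sigma>) \<le> ennreal (real m * P)"

definition admissible_code ::
  "real \<Rightarrow> real \<Rightarrow> nat \<Rightarrow> ((nat \<Rightarrow> real) \<Rightarrow> (nat \<Rightarrow> real)) \<Rightarrow> ((nat \<Rightarrow> real) \<Rightarrow> (nat \<Rightarrow> real)) \<Rightarrow> bool" where
  "admissible_code \<sigma> P m enc dec \<longleftrightarrow>
     enc \<in> vec_borel m \<rightarrow>\<^sub>M vec_borel m \<and> dec \<in> vec_borel m \<rightarrow>\<^sub>M vec_borel m \<and>
     power_constraint \<sigma> P m enc"

text \<open>
  The host signal and the channel noise are the two coordinates of the product of their laws,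
  which makes them independent.
\<close>

definition expected_distortion ::
  "real \<Rightarrow> nat \<Rightarrow> ((nat \<Rightarrow> real) \<Rightarrow> (nat \<Rightarrow> real)) \<Rightarrow> ((nat \<Rightarrow> real) \<Rightarrow> (nat \<Rightarrow> real)) \<Rightarrow> ennreal" where
  "expected_distortion \<sigma> m enc dec =
     (\<integral>\<^sup>+ (x0, z). ennreal (distortion m (enc x0) (dec (vec_add m (enc x0) z)))
        \<partial>(gaussian_vec m \<sigma> \<Otimes>\<^sub>M gaussian_vec m 1))"

definition MMSE0 :: "real \<Rightarrow> real \<Rightarrow> ennreal" where
  "MMSE0 \<sigma> P =
     (INF (enc, dec) \<in> {(enc, dec). \<forall>m\<ge>1. admissible_code \<sigma> P m (enc m) (dec m)}.
        limsup (\<lambda>m. expected_distortion \<sigma> m (enc m) (dec m)))"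

text \<open>
  The objective is nonnegative; taking infimum and supremum in \<open>ennreal\<close> avoids any
  boundedness side condition.
\<close>

definition lower_bound :: "real \<Rightarrow> real \<Rightarrow> ennreal" where
  "lower_bound \<sigma> P =
     (INF \<sigma>XV \<in> {- (\<sigma> * sqrt P) .. \<sigma> * sqrt P}. SUP \<gamma> \<in> UNIV - {0}.
        ennreal (1 / \<gamma>\<^sup>2 *
          (max (sqrt (\<sigma>\<^sup>2 / (1 + \<sigma>\<^sup>2 + P + 2 * \<sigma>XV))
                - sqrt ((1 - \<gamma>)\<^sup>2 * \<sigma>\<^sup>2 + \<gamma>\<^sup>2 * P - 2 * \<gamma> * (1 - \<gamma>) * \<sigma>XV)) 0)\<^sup>2))"

end

theory Submission
  imports Defs
begin

text \<open>
  Let \<open>m s\<close> be the correlation of host and input, and let \<open>Q = \<sigma>\<^sup>2 + P + 2 s\<close>, so that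
  \<open>m Q\<close> bounds the energy of \<open>X\<^sub>1\<close>. Any estimator of \<open>X\<^sub>0\<close> from \<open>Y = X\<^sub>1 + Z\<close> has mean square error
  at least \<open>m \<sigma>\<^sup>2 / (1 + Q)\<close>: this follows from a single application of Gibbs' inequality, comparing the law of
  \<open>(X\<^sub>0, Y)\<close> with the law for which \<open>Y \<sim> N(0, (1 + Q) I)\<close> and \<open>X\<^sub>0\<close> given \<open>Y\<close> is Gaussian around the estimate with
  variance \<open>\<sigma>\<^sup>2 / (1 + Q)\<close>; this choice merges the converse for the rate distortion function with the
  capacity bound, and the normalising constants cancel. Applied to \<open>\<gamma>\<close> times the decoder output,
  the triangle inequality in \<open>L\<^sup>2\<close> for
  \<open>X\<^sub>0 - \<gamma> D(Y) = (X\<^sub>0 - \<gamma> X\<^sub>1) + \<gamma> (X\<^sub>1 - D(Y))\<close> gives the bound. A code using less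
  power than \<open>P\<close> is covered because the bound for fixed \<open>s\<close> decreases in \<open>P\<close>.
\<close>

section \<open>Gaussian densities and translation invariance in dimension \<open>m\<close>\<close>

definition gauss_density :: "nat \<Rightarrow> real \<Rightarrow> (nat \<Rightarrow> real) \<Rightarrow> real" where
  "gauss_density m s x = (\<Prod>i<m. normal_density 0 s (x i))"

definition vec_diff :: "nat \<Rightarrow> (nat \<Rightarrow> real) \<Rightarrow> (nat \<Rightarrow> real) \<Rightarrow> (nat \<Rightarrow> real)" where
  "vec_diff m x y = (\<lambda>i\<in>{..<m}. x i - y i)"

text \<open>Lets translation invariance, stated for \<open>vec_add\<close>, also apply to centering
  at an estimate.\<close>

lemma vec_diff_eq_vec_add: "vec_diff m x y = vec_add m (\<lambda>i. - y i) x"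
  by (simp add: vec_diff_def vec_add_def)

abbreviation lborel_vec :: "nat \<Rightarrow> (nat \<Rightarrow> real) measure" where
  "lborel_vec m \<equiv> Pi\<^sub>M {..<m} (\<lambda>_. lborel)"

interpretation lborel_prod: product_sigma_finite "\<lambda>_::nat. lborel :: real measure" ..

lemma sets_lborel_vec [measurable_cong]: "sets (lborel_vec m) = sets (vec_borel m)"
  by (intro sets_PiM_cong) auto

lemma sigma_finite_lborel_vec: "sigma_finite_measure (lborel_vec m)"
  by (rule lborel_prod.sigma_finite) simp

lemma gauss_density_nonneg [simp]: "0 \<le> gauss_density m s x"
  by (auto simp: gauss_density_def intro!: prod_nonneg)

lemma gauss_density_pos: "0 < s \<Longrightarrow> 0 < gauss_density m s x"
  by (auto simp: gauss_density_def intro!: prod_pos normal_density_pos)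

lemma gauss_density_measurable [measurable]: "gauss_density m s \<in> borel_measurable (vec_borel m)"
  unfolding gauss_density_def by measurable

lemma gauss_density_altdef:
  assumes "0 < s"
  shows "gauss_density m s x = exp (- (\<Sum>i<m. (x i)\<^sup>2) / (2 * s\<^sup>2)) / (s * sqrt (2 * pi)) ^ m"
proof -
  have "normal_density 0 s t = exp (- (t\<^sup>2 / (2 * s\<^sup>2))) / (s * sqrt (2 * pi))" for t
    using assms by (simp add: normal_density_def real_sqrt_mult field_simps)
  then show ?thesis
    by (simp add: gauss_density_def prod_dividef exp_sum[symmetric] sum_divide_distrib[symmetric] sum_negf)
qed

text \<open>A product measure is determined by its values on boxes, and each side of a box keeps its
  length under a translation of the line.\<close>

lemma nn_integral_lborel_vec_shift:
  assumes [measurable]: "f \<in> borel_measurable (vec_borel m)"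
  shows "(\<integral>\<^sup>+z. f (vec_add m a z) \<partial>lborel_vec m) = (\<integral>\<^sup>+z. f z \<partial>lborel_vec m)"
proof -
  have meas [measurable]: "vec_add m a \<in> lborel_vec m \<rightarrow>\<^sub>M lborel_vec m"
    unfolding vec_add_def[abs_def] by measurable
  have "distr (lborel_vec m) (lborel_vec m) (vec_add m a) = lborel_vec m"
  proof (rule lborel_prod.PiM_eqI)
    fix A :: "nat \<Rightarrow> real set" assume A: "\<And>i. i \<in> {..<m} \<Longrightarrow> A i \<in> sets lborel"
    have "emeasure (distr (lborel_vec m) (lborel_vec m) (vec_add m a)) (Pi\<^sub>E {..<m} A)
        = emeasure (lborel_vec m) (vec_add m a -` Pi\<^sub>E {..<m} A \<inter> space (lborel_vec m))"
      using A by (intro emeasure_distr meas sets_PiM_I_finite) auto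
    also have "vec_add m a -` Pi\<^sub>E {..<m} A \<inter> space (lborel_vec m) = Pi\<^sub>E {..<m} (\<lambda>i. (+) (a i) -` A i)"
      by (auto simp: vec_add_def space_PiM PiE_def Pi_def)
    also have "emeasure (lborel_vec m) \<dots> = (\<Prod>i<m. emeasure lborel ((+) (a i) -` A i))"
    proof (rule lborel_prod.emeasure_PiM)
      fix i assume "i \<in> {..<m}"
      with A have "A i \<in> sets borel" by simp
      then show "(+) (a i) -` A i \<in> sets lborel"
        using measurable_sets_borel[of "(+) (a i)" borel "A i"] by simp
    qed simp
    also have "\<dots> = (\<Prod>i<m. emeasure lborel (A i))"
    proof (rule prod.cong)
      fix i assume "i \<in> {..<m}"
      then have "A i \<in> sets borel" using A[of i] by simp
      then show "emeasure lborel ((+) (a i) -` A i) = emeasure lborel (A i)"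
        using emeasure_distr[of "(+) (a i)" lborel borel "A i"] by (simp add: lborel_distr_plus)
    qed simp
    finally show "emeasure (distr (lborel_vec m) (lborel_vec m) (vec_add m a)) (Pi\<^sub>E {..<m} A)
        = (\<Prod>i<m. emeasure lborel (A i))" .
  qed auto
  moreover have "(\<integral>\<^sup>+z. f z \<partial>distr (lborel_vec m) (lborel_vec m) (vec_add m a)) = (\<integral>\<^sup>+z. f (vec_add m a z) \<partial>lborel_vec m)"
    by (rule nn_integral_distr) (rule meas, measurable)
  ultimately show ?thesis by simp
qed

lemma nn_integral_gauss_density:
  assumes "0 < s"
  shows "(\<integral>\<^sup>+x. ennreal (gauss_density m s x) \<partial>lborel_vec m) = 1"
proof -
  have "(\<integral>\<^sup>+x. ennreal (gauss_density m s x) \<partial>lborel_vec m)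
      = (\<integral>\<^sup>+x. (\<Prod>i<m. ennreal (normal_density 0 s (x i))) \<partial>lborel_vec m)"
    by (simp add: gauss_density_def prod_ennreal)
  also have "\<dots> = (\<Prod>i<m. \<integral>\<^sup>+x. ennreal (normal_density 0 s x) \<partial>lborel)"
    by (rule lborel_prod.product_nn_integral_prod) auto
  also have "\<dots> = 1"
    using assms by (simp add: nn_integral_eq_integral)
  finally show ?thesis .
qed

text \<open>Both measures agree on boxes: indicator and density factor over the coordinates, so the
  integral splits into one-dimensional ones. A density with respect to Lebesgue measure is what
  likelihood ratios require.\<close>

lemma gaussian_vec_eq_density:
  assumes "0 < s"
  shows "gaussian_vec m s = density (lborel_vec m) (\<lambda>x. ennreal (gauss_density m s x))"
proof -
  let ?N = "density lborel (\<lambda>x. ennreal (normal_density 0 s x))"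
  interpret N: prob_space ?N using assms by (rule prob_space_normal_density)
  interpret P: product_sigma_finite "\<lambda>_::nat. ?N" ..
  have "density (lborel_vec m) (\<lambda>x. ennreal (gauss_density m s x)) = Pi\<^sub>M {..<m} (\<lambda>_. ?N)"
  proof (rule P.PiM_eqI)
    show "sets (density (lborel_vec m) (\<lambda>x. ennreal (gauss_density m s x))) = sets (Pi\<^sub>M {..<m} (\<lambda>_. ?N))"
      by (simp, intro sets_PiM_cong) auto
    fix A :: "nat \<Rightarrow> real set" assume A: "\<And>i. i \<in> {..<m} \<Longrightarrow> A i \<in> sets ?N"
    have ind: "indicator (Pi\<^sub>E {..<m} A) x = (\<Prod>i<m. indicator (A i) (x i) :: ennreal)"
      if "x \<in> space (lborel_vec m)" for x
      using that by (auto simp: indicator_def space_PiM PiE_def Pi_def prod_zero_iff intro: prod_eq_1_iff)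
    have "emeasure (density (lborel_vec m) (\<lambda>x. ennreal (gauss_density m s x))) (Pi\<^sub>E {..<m} A)
        = (\<integral>\<^sup>+x. ennreal (gauss_density m s x) * indicator (Pi\<^sub>E {..<m} A) x \<partial>lborel_vec m)"
      using A by (intro emeasure_density sets_PiM_I_finite) auto
    also have "\<dots> = (\<integral>\<^sup>+x. (\<Prod>i<m. ennreal (normal_density 0 s (x i)) * indicator (A i) (x i)) \<partial>lborel_vec m)"
      by (intro nn_integral_cong) (simp add: ind gauss_density_def prod_ennreal prod.distrib)
    also have "\<dots> = (\<Prod>i<m. \<integral>\<^sup>+x. ennreal (normal_density 0 s x) * indicator (A i) x \<partial>lborel)"
      using A by (intro lborel_prod.product_nn_integral_prod) auto
    also have "\<dots> = (\<Prod>i<m. emeasure ?N (A i))"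
      using A by (intro prod.cong) (auto simp: emeasure_density)
    finally show "emeasure (density (lborel_vec m) (\<lambda>x. ennreal (gauss_density m s x))) (Pi\<^sub>E {..<m} A)
        = (\<Prod>i<m. emeasure ?N (A i))" .
  qed simp
  then show ?thesis by (simp add: gaussian_vec_def)
qed

lemma prob_space_gaussian_vec: "0 < s \<Longrightarrow> prob_space (gaussian_vec m s)"
  unfolding gaussian_vec_def by (intro prob_space_PiM prob_space_normal_density)

lemma sets_gaussian_vec [measurable_cong]: "sets (gaussian_vec m s) = sets (vec_borel m)"
  unfolding gaussian_vec_def by (intro sets_PiM_cong) auto

lemma vec_add_measurable [measurable (raw)]:
  assumes "f \<in> M \<rightarrow>\<^sub>M vec_borel m" "g \<in> M \<rightarrow>\<^sub>M vec_borel m"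
  shows "(\<lambda>w. vec_add m (f w) (g w)) \<in> M \<rightarrow>\<^sub>M vec_borel m"
  unfolding vec_add_def
  by (intro measurable_restrict borel_measurable_add
      measurable_compose[OF assms(1)] measurable_compose[OF assms(2)] measurable_component_singleton)

lemma vec_diff_measurable [measurable (raw)]:
  assumes "f \<in> M \<rightarrow>\<^sub>M vec_borel m" "g \<in> M \<rightarrow>\<^sub>M vec_borel m"
  shows "(\<lambda>w. vec_diff m (f w) (g w)) \<in> M \<rightarrow>\<^sub>M vec_borel m"
  unfolding vec_diff_def
  by (intro measurable_restrict borel_measurable_diff
      measurable_compose[OF assms(1)] measurable_compose[OF assms(2)] measurable_component_singleton)

section \<open>Total mass of the comparison law\<close>

text \<open>The integrand is the density ratio of the comparison law to the true law, so the true
  densities cancel and only the comparison density \<open>?k\<close> remains to be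
  integrated.\<close>

lemma nn_integral_gaussian_change_of_measure:
  assumes \<sigma>: "0 < \<sigma>" and a: "0 < a" and b: "0 < b"
    and e [measurable]: "e \<in> vec_borel m \<rightarrow>\<^sub>M vec_borel m"
    and g [measurable]: "g \<in> vec_borel m \<rightarrow>\<^sub>M vec_borel m"
  shows "(\<integral>\<^sup>+(x, z). ennreal (gauss_density m a (vec_add m (e x) z)
            * gauss_density m b (vec_diff m x (g (vec_add m (e x) z)))
            / (gauss_density m \<sigma> x * gauss_density m 1 z)) \<partial>(gaussian_vec m \<sigma> \<Otimes>\<^sub>M gaussian_vec m 1)) = 1"
    (is "(\<integral>\<^sup>+(x, z). ennreal (?h x z) \<partial>?G) = 1")
proof -
  interpret L: sigma_finite_measure "lborel_vec m" by (rule sigma_finite_lborel_vec)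
  interpret LL: pair_sigma_finite "lborel_vec m" "lborel_vec m" ..
  interpret Z: prob_space "gaussian_vec m 1" by (rule prob_space_gaussian_vec) simp
  let ?k = "\<lambda>x y. ennreal (gauss_density m a y * gauss_density m b (vec_diff m x (g y)))"
  have G: "?G = density (lborel_vec m \<Otimes>\<^sub>M lborel_vec m)
      (\<lambda>(x, z). ennreal (gauss_density m \<sigma> x) * ennreal (gauss_density m 1 z))"
    unfolding gaussian_vec_eq_density[OF \<sigma>] gaussian_vec_eq_density[OF zero_less_one]
    by (rule pair_measure_density)
      (use Z.sigma_finite_measure_axioms gaussian_vec_eq_density[of 1 m] in \<open>auto simp: sigma_finite_lborel_vec\<close>)
  have "(\<integral>\<^sup>+(x, z). ennreal (?h x z) \<partial>?G)
      = (\<integral>\<^sup>+(x, z). ?k x (vec_add m (e x) z) \<partial>(lborel_vec m \<Otimes>\<^sub>M lborel_vec m))"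
    unfolding G
    apply (subst nn_integral_density)
      apply measurable
    apply (intro nn_integral_cong)
    apply (clarsimp simp: ennreal_mult[symmetric])
    using gauss_density_pos[OF \<sigma>, of m] gauss_density_pos[of 1 m]
    by (simp add: less_imp_neq[symmetric])
  also have "\<dots> = (\<integral>\<^sup>+x. \<integral>\<^sup>+z. ?k x (vec_add m (e x) z) \<partial>lborel_vec m \<partial>lborel_vec m)"
    by (subst L.nn_integral_fst[symmetric]) auto
  \<comment> \<open>For fixed \<open>x\<close>, passing from the noise to the channel output is a
    translation by \<open>e x\<close>, so measurability of \<open>e\<close> suffices.\<close>
  also have "\<dots> = (\<integral>\<^sup>+x. \<integral>\<^sup>+y. ?k x y \<partial>lborel_vec m \<partial>lborel_vec m)"
  proof (rule nn_integral_cong)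
    fix x assume "x \<in> space (lborel_vec m)"
    then have [measurable]: "x \<in> space (vec_borel m)" by (simp add: space_PiM)
    show "(\<integral>\<^sup>+z. ?k x (vec_add m (e x) z) \<partial>lborel_vec m) = (\<integral>\<^sup>+y. ?k x y \<partial>lborel_vec m)"
      by (rule nn_integral_lborel_vec_shift) measurable
  qed
  \<comment> \<open>With \<open>y\<close> fixed, \<open>g y\<close> is a constant, and the inner
    integral over \<open>x\<close> is that of a translated Gaussian density.\<close>
  also have "\<dots> = (\<integral>\<^sup>+y. \<integral>\<^sup>+x. ?k x y \<partial>lborel_vec m \<partial>lborel_vec m)"
    by (intro LL.Fubini'[symmetric]) measurable
  also have "\<dots> = (\<integral>\<^sup>+y. ennreal (gauss_density m a y) \<partial>lborel_vec m)"
  proof (rule nn_integral_cong)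
    fix y assume "y \<in> space (lborel_vec m)"
    then have [measurable]: "y \<in> space (vec_borel m)" by (simp add: space_PiM)
    have "(\<integral>\<^sup>+x. ?k x y \<partial>lborel_vec m) = ennreal (gauss_density m a y)
        * (\<integral>\<^sup>+x. ennreal (gauss_density m b (vec_diff m x (g y))) \<partial>lborel_vec m)"
      by (simp add: ennreal_mult nn_integral_cmult)
    then show "(\<integral>\<^sup>+x. ?k x y \<partial>lborel_vec m) = ennreal (gauss_density m a y)"
      by (simp only: vec_diff_eq_vec_add nn_integral_gauss_density[OF b] mult_1_right
          nn_integral_lborel_vec_shift[of "\<lambda>x. ennreal (gauss_density m b x)"] gauss_density_measurable measurable_compose[OF gauss_density_measurable measurable_ennreal])
  qed
  also have "\<dots> = 1" by (rule nn_integral_gauss_density[OF a])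
  finally show ?thesis .
qed

section \<open>Cauchy-Schwarz and Minkowski inequalities for random vectors\<close>

lemma integrable_mult_square_integrable:
  fixes f g :: "'a \<Rightarrow> real"
  assumes [measurable]: "f \<in> borel_measurable M" "g \<in> borel_measurable M"
    and "integrable M (\<lambda>x. (f x)\<^sup>2)" "integrable M (\<lambda>x. (g x)\<^sup>2)"
  shows "integrable M (\<lambda>x. f x * g x)"
proof (rule Bochner_Integration.integrable_bound)
  show "integrable M (\<lambda>x. (f x)\<^sup>2 + (g x)\<^sup>2)" using assms by simp
  have "\<bar>a * b\<bar> \<le> a\<^sup>2 + b\<^sup>2" for a b :: real
    using sum_squares_bound[of "\<bar>a\<bar>" "\<bar>b\<bar>"] mult_nonneg_nonneg[OF abs_ge_zero[of a] abs_ge_zero[of b]]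
    unfolding abs_mult power2_abs by linarith
  then show "AE x in M. norm (f x * g x) \<le> norm ((f x)\<^sup>2 + (g x)\<^sup>2)"
    by simp
qed simp

text \<open>Besides the two inequalities below, this yields the energies of the encoder output and
  of \<open>X0 - \<gamma> X1\<close> in terms of second moments of host and input.\<close>

lemma integrable_square_lincomb:
  fixes f g :: "'a \<Rightarrow> real"
  assumes "f \<in> borel_measurable M" "g \<in> borel_measurable M"
    and "integrable M (\<lambda>x. (f x)\<^sup>2)" "integrable M (\<lambda>x. (g x)\<^sup>2)"
  shows "integrable M (\<lambda>x. (a * f x + b * g x)\<^sup>2)"
    and "(\<integral>x. (a * f x + b * g x)\<^sup>2 \<partial>M)
      = a\<^sup>2 * (\<integral>x. (f x)\<^sup>2 \<partial>M) + 2 * a * b * (\<integral>x. f x * g x \<partial>M) + b\<^sup>2 * (\<integral>x. (g x)\<^sup>2 \<partial>M)"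
proof -
  have eq: "(a * f x + b * g x)\<^sup>2 = a\<^sup>2 * (f x)\<^sup>2 + 2 * a * b * (f x * g x) + b\<^sup>2 * (g x)\<^sup>2" for x
    by (simp add: power2_sum power_mult_distrib)
  note fg = integrable_mult_square_integrable[OF assms]
  show "integrable M (\<lambda>x. (a * f x + b * g x)\<^sup>2)"
    unfolding eq using assms fg by (intro Bochner_Integration.integrable_add integrable_mult_right)
  show "(\<integral>x. (a * f x + b * g x)\<^sup>2 \<partial>M)
      = a\<^sup>2 * (\<integral>x. (f x)\<^sup>2 \<partial>M) + 2 * a * b * (\<integral>x. f x * g x \<partial>M) + b\<^sup>2 * (\<integral>x. (g x)\<^sup>2 \<partial>M)"
    unfolding eq using assms fg by simp
qed

lemma quadratic_nonneg_discriminant: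
  fixes A B C :: real
  assumes "0 \<le> B" and "\<And>t. 0 \<le> A + 2 * t * C + t\<^sup>2 * B"
  shows "C\<^sup>2 \<le> A * B"
proof (cases "B = 0")
  case True
  show ?thesis
  proof (cases "C = 0")
    case False
    \<comment> \<open>The quadratic degenerates to a nonconstant affine function of
      \<open>t\<close>; this \<open>t\<close> gives it the value -1.\<close>
    then show ?thesis using assms(2)[of "- (A + 1) / (2 * C)"] True by (simp add: field_simps)
  qed (use True in simp)
next
  case False
  with assms(1) have B: "B > 0" by simp
  \<comment> \<open>The minimiser of the quadratic.\<close>
  have "0 \<le> A + 2 * (- C / B) * C + (- C / B)\<^sup>2 * B" by (rule assms(2))
  also have "\<dots> = A - C\<^sup>2 / B" using B by (simp add: power2_eq_square)
  finally show ?thesis using B by (simp add: field_simps)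
qed

text \<open>The sum of integrals acts as an inner product on families of functions; the squared norm
  of \<open>f + t g\<close> is a nonnegative quadratic in \<open>t\<close>.\<close>

lemma sum_integral_Cauchy_Schwarz:
  fixes f g :: "'i \<Rightarrow> 'a \<Rightarrow> real"
  assumes "\<And>i. i \<in> I \<Longrightarrow> f i \<in> borel_measurable M" "\<And>i. i \<in> I \<Longrightarrow> g i \<in> borel_measurable M"
    and "\<And>i. i \<in> I \<Longrightarrow> integrable M (\<lambda>x. (f i x)\<^sup>2)" "\<And>i. i \<in> I \<Longrightarrow> integrable M (\<lambda>x. (g i x)\<^sup>2)"
  shows "(\<Sum>i\<in>I. \<integral>x. f i x * g i x \<partial>M)\<^sup>2
    \<le> (\<Sum>i\<in>I. \<integral>x. (f i x)\<^sup>2 \<partial>M) * (\<Sum>i\<in>I. \<integral>x. (g i x)\<^sup>2 \<partial>M)"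
proof (rule quadratic_nonneg_discriminant)
  show "0 \<le> (\<Sum>i\<in>I. \<integral>x. (g i x)\<^sup>2 \<partial>M)" by (intro sum_nonneg) simp
  fix t
  have "0 \<le> (\<Sum>i\<in>I. \<integral>x. (1 * f i x + t * g i x)\<^sup>2 \<partial>M)" by (intro sum_nonneg) simp
  also have "\<dots> = (\<Sum>i\<in>I. (\<integral>x. (f i x)\<^sup>2 \<partial>M) + 2 * t * (\<integral>x. f i x * g i x \<partial>M) + t\<^sup>2 * (\<integral>x. (g i x)\<^sup>2 \<partial>M))"
    using assms by (intro sum.cong) (simp_all add: integrable_square_lincomb(2)[where a = 1, simplified])
  finally show "0 \<le> (\<Sum>i\<in>I. \<integral>x. (f i x)\<^sup>2 \<partial>M) + 2 * t * (\<Sum>i\<in>I. \<integral>x. f i x * g i x \<partial>M)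
      + t\<^sup>2 * (\<Sum>i\<in>I. \<integral>x. (g i x)\<^sup>2 \<partial>M)"
    by (simp add: sum.distrib sum_distrib_left)
qed

lemma sum_integral_Minkowski:
  fixes f g :: "'i \<Rightarrow> 'a \<Rightarrow> real"
  assumes "\<And>i. i \<in> I \<Longrightarrow> f i \<in> borel_measurable M" "\<And>i. i \<in> I \<Longrightarrow> g i \<in> borel_measurable M"
    and "\<And>i. i \<in> I \<Longrightarrow> integrable M (\<lambda>x. (f i x)\<^sup>2)" "\<And>i. i \<in> I \<Longrightarrow> integrable M (\<lambda>x. (g i x)\<^sup>2)"
  shows "sqrt (\<Sum>i\<in>I. \<integral>x. (f i x + g i x)\<^sup>2 \<partial>M)
    \<le> sqrt (\<Sum>i\<in>I. \<integral>x. (f i x)\<^sup>2 \<partial>M) + sqrt (\<Sum>i\<in>I. \<integral>x. (g i x)\<^sup>2 \<partial>M)"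
proof -
  define A B C where "A = (\<Sum>i\<in>I. \<integral>x. (f i x)\<^sup>2 \<partial>M)" and "B = (\<Sum>i\<in>I. \<integral>x. (g i x)\<^sup>2 \<partial>M)"
    and "C = (\<Sum>i\<in>I. \<integral>x. f i x * g i x \<partial>M)"
  have nonneg: "0 \<le> A" "0 \<le> B" unfolding A_def B_def by (auto intro!: sum_nonneg)
  have "C\<^sup>2 \<le> A * B" unfolding A_def B_def C_def by (rule sum_integral_Cauchy_Schwarz[OF assms])
  then have "C \<le> sqrt A * sqrt B"
    by (metis real_le_rsqrt real_sqrt_mult)
  have "(\<Sum>i\<in>I. \<integral>x. (f i x + g i x)\<^sup>2 \<partial>M) = A + 2 * C + B"
    unfolding A_def B_def C_def sum_distrib_left sum.distrib[symmetric]
    using assms by (intro sum.cong refl) (simp add: integrable_square_lincomb(2)[where a = 1 and b = 1, simplified])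
  also have "\<dots> \<le> (sqrt A + sqrt B)\<^sup>2"
    using nonneg \<open>C \<le> _\<close> by (simp add: power2_sum)
  finally have "sqrt (\<Sum>i\<in>I. \<integral>x. (f i x + g i x)\<^sup>2 \<partial>M) \<le> sqrt A + sqrt B"
    using nonneg by (intro real_le_lsqrt) auto
  then show ?thesis by (simp add: A_def B_def)
qed

section \<open>Independence and Gaussian moments\<close>

text \<open>Used in two ways: a constant factor 1 lifts an integral over host or noise alone to the
  pair, and a factor of mean zero removes a cross term.\<close>

lemma has_bochner_integral_pair_mult:
  fixes f :: "'a \<Rightarrow> real" and g :: "'b \<Rightarrow> real"
  assumes "sigma_finite_measure M1" "sigma_finite_measure M2"
    and f: "has_bochner_integral M1 f u" and g: "has_bochner_integral M2 g v"
  shows "has_bochner_integral (M1 \<Otimes>\<^sub>M M2) (\<lambda>(x, y). f x * g y) (u * v)"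
proof -
  interpret M1: sigma_finite_measure M1 by fact
  interpret M2: sigma_finite_measure M2 by fact
  interpret P: pair_sigma_finite M1 M2 ..
  have int: "integrable M1 f" "integrable M2 g" and val: "integral\<^sup>L M1 f = u" "integral\<^sup>L M2 g = v"
    using f g by (auto simp: has_bochner_integral_iff)
  have [measurable]: "f \<in> borel_measurable M1" "g \<in> borel_measurable M2" using int by auto
  have *: "integrable (M1 \<Otimes>\<^sub>M M2) (\<lambda>(x, y). f x * g y)"
    by (rule P.Fubini_integrable) (use int in \<open>auto simp: abs_mult\<close>)
  moreover have "(\<integral>p. (\<lambda>(x, y). f x * g y) p \<partial>(M1 \<Otimes>\<^sub>M M2)) = u * v"
    by (subst P.integral_fst'[OF *, symmetric]) (simp add: val)
  ultimately show ?thesis by (simp add: has_bochner_integral_iff)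
qed

text \<open>Each coordinate projection has the one-dimensional normal law, whose moments are
  known.\<close>

lemma gaussian_vec_moments:
  assumes s: "0 < s" and i: "i < m"
  shows "has_bochner_integral (gaussian_vec m s) (\<lambda>x. x i) 0"
    and "has_bochner_integral (gaussian_vec m s) (\<lambda>x. (x i)\<^sup>2) (s\<^sup>2)"
proof -
  let ?N = "density lborel (\<lambda>x. ennreal (normal_density 0 s x))"
  have comp: "?N = distr (gaussian_vec m s) ?N (\<lambda>x. x i)"
    unfolding gaussian_vec_def
    using s i by (intro distr_PiM_component[symmetric] prob_space_normal_density) auto
  have comp_meas: "(\<lambda>x. x i) \<in> gaussian_vec m s \<rightarrow>\<^sub>M ?N"
    unfolding gaussian_vec_def using i by (intro measurable_component_singleton) auto
  have lift: "has_bochner_integral (gaussian_vec m s) (\<lambda>x. f (x i)) c"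
    if "has_bochner_integral lborel (\<lambda>x. normal_density 0 s x * f x) c"
      and [measurable]: "f \<in> borel_measurable borel" for f :: "real \<Rightarrow> real" and c
  proof -
    have "has_bochner_integral ?N f c"
      using that by (intro has_bochner_integral_density) auto
    then have "has_bochner_integral (distr (gaussian_vec m s) ?N (\<lambda>x. x i)) f c"
      using comp by simp
    then show ?thesis
      using integral_distr[OF comp_meas, of f] integrable_distr[OF comp_meas, of f]
      by (simp add: has_bochner_integral_iff)
  qed
  show "has_bochner_integral (gaussian_vec m s) (\<lambda>x. x i) 0"
    by (rule lift) (use normal_moment_nz_1[OF s, of 0] in auto)
  show "has_bochner_integral (gaussian_vec m s) (\<lambda>x. (x i)\<^sup>2) (s\<^sup>2)"
    by (rule lift) (use normal_moment_even[OF s, of 0 1] s in auto)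
qed

section \<open>Mean square error of estimating the host from the channel output\<close>

text \<open>With \<open>c = 1 + Q\<close>, the log-likelihood ratio \<open>L\<close> of the true law
  to the comparison law has nonnegative mean. That mean is at most
  \<open>m / 2 + c / (2 * \<sigma>\<^sup>2) * D - m\<close>, which bounds the error \<open>D\<close>
  from below.\<close>

lemma gaussian_estimation_lower_bound:
  assumes \<sigma>: "0 < \<sigma>" and Q: "0 < 1 + Q"
    and e [measurable]: "e \<in> vec_borel m \<rightarrow>\<^sub>M vec_borel m"
    and g [measurable]: "g \<in> vec_borel m \<rightarrow>\<^sub>M vec_borel m"
    and e2: "\<And>i. i < m \<Longrightarrow> integrable (gaussian_vec m \<sigma>) (\<lambda>x. (e x i)\<^sup>2)"
    and eQ: "(\<Sum>i<m. \<integral>x. (e x i)\<^sup>2 \<partial>gaussian_vec m \<sigma>) \<le> real m * Q"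
    and d2: "\<And>i. i < m \<Longrightarrow> integrable (gaussian_vec m \<sigma> \<Otimes>\<^sub>M gaussian_vec m 1)
          (\<lambda>(x, z). (x i - g (vec_add m (e x) z) i)\<^sup>2)"
  shows "real m * \<sigma>\<^sup>2 / (1 + Q)
    \<le> (\<Sum>i<m. \<integral>(x, z). (x i - g (vec_add m (e x) z) i)\<^sup>2 \<partial>(gaussian_vec m \<sigma> \<Otimes>\<^sub>M gaussian_vec m 1))"
proof -
  interpret X: prob_space "gaussian_vec m \<sigma>" by (rule prob_space_gaussian_vec[OF \<sigma>])
  interpret Z: prob_space "gaussian_vec m 1" by (rule prob_space_gaussian_vec) simp
  define G where "G = gaussian_vec m \<sigma> \<Otimes>\<^sub>M gaussian_vec m 1"
  define c where "c = 1 + Q"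
  define y where "y x z = vec_add m (e x) z" for x z
  define D where "D = (\<Sum>i<m. \<integral>(x, z). (x i - g (y x z) i)\<^sup>2 \<partial>G)"
  note pairI = has_bochner_integral_pair_mult[OF X.sigma_finite_measure_axioms Z.sigma_finite_measure_axioms,
      folded G_def]
  have sets_G [measurable_cong]: "sets G = sets (vec_borel m \<Otimes>\<^sub>M vec_borel m)"
    unfolding G_def by (intro sets_pair_measure_cong sets_gaussian_vec)
  have one: "has_bochner_integral (gaussian_vec m \<sigma>) (\<lambda>_. 1) (1::real)"
      "has_bochner_integral (gaussian_vec m 1) (\<lambda>_. 1) (1::real)"
    by (simp_all add: has_bochner_integral_iff X.prob_space Z.prob_space)
  have e': "e \<in> gaussian_vec m \<sigma> \<rightarrow>\<^sub>M vec_borel m" by measurable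
  have e1: "integrable (gaussian_vec m \<sigma>) (\<lambda>x. e x i)" if "i < m" for i
    using e2[OF that] that
    by (intro X.square_integrable_imp_integrable[OF measurable_compose[OF e' measurable_component_singleton]]) auto
  have x_sq: "has_bochner_integral G (\<lambda>(x, z). (x i)\<^sup>2) (\<sigma>\<^sup>2)" if "i < m" for i
    using pairI[OF gaussian_vec_moments(2)[OF \<sigma> that] one(2)] by simp
  have z_sq: "has_bochner_integral G (\<lambda>(x, z). (z i)\<^sup>2) 1" if "i < m" for i
    using pairI[OF one(1) gaussian_vec_moments(2)[OF zero_less_one that]] by simp
  \<comment> \<open>The cross term vanishes because the noise is independent of the host and
    centered; the summand 1 is the noise variance.\<close>
  have y_sq: "has_bochner_integral G (\<lambda>(x, z). (y x z i)\<^sup>2) ((\<integral>x. (e x i)\<^sup>2 \<partial>gaussian_vec m \<sigma>) + 1)"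
    if "i < m" for i
  proof -
    have "has_bochner_integral G (\<lambda>p. ((\<lambda>(x, z). (e x i)\<^sup>2 * 1) p + (\<lambda>(x, z). 2 * e x i * z i) p) + (\<lambda>(x, z). (z i)\<^sup>2) p)
        ((\<integral>x. (e x i)\<^sup>2 \<partial>gaussian_vec m \<sigma>) * 1 + (\<integral>x. 2 * e x i \<partial>gaussian_vec m \<sigma>) * 0 + 1)"
      using e2[OF that] e1[OF that] that
      by (intro has_bochner_integral_add pairI one z_sq gaussian_vec_moments(1) has_bochner_integral_integrable) auto
    then show ?thesis
      using that by (simp add: y_def vec_add_def power2_sum case_prod_beta' algebra_simps)
  qed
  \<comment> \<open>Only the Gaussian exponents enter; the normalising constants of the two laws
    turn out to be equal.\<close>
  define L where "L = (\<lambda>(x, z). \<Sum>i<m. ((y x z i)\<^sup>2 / (2 * c) + c / (2 * \<sigma>\<^sup>2) * (x i - g (y x z) i)\<^sup>2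
      - (x i)\<^sup>2 / (2 * \<sigma>\<^sup>2) - (z i)\<^sup>2 / 2))"
  have D_int: "has_bochner_integral G (\<lambda>(x, z). (x i - g (y x z) i)\<^sup>2) (\<integral>(x, z). (x i - g (y x z) i)\<^sup>2 \<partial>G)"
    if "i < m" for i
    using d2[OF that] unfolding y_def G_def by (rule has_bochner_integral_integrable)
  have "has_bochner_integral G (\<lambda>p. \<Sum>i<m. ((\<lambda>(x, z). (y x z i)\<^sup>2) p / (2 * c)
        + c / (2 * \<sigma>\<^sup>2) * (\<lambda>(x, z). (x i - g (y x z) i)\<^sup>2) p
        - (\<lambda>(x, z). (x i)\<^sup>2) p / (2 * \<sigma>\<^sup>2) - (\<lambda>(x, z). (z i)\<^sup>2) p / 2))
      (\<Sum>i<m. (((\<integral>x. (e x i)\<^sup>2 \<partial>gaussian_vec m \<sigma>) + 1) / (2 * c)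
        + c / (2 * \<sigma>\<^sup>2) * (\<integral>(x, z). (x i - g (y x z) i)\<^sup>2 \<partial>G) - \<sigma>\<^sup>2 / (2 * \<sigma>\<^sup>2) - 1 / 2))"
    by (intro has_bochner_integral_sum has_bochner_integral_add has_bochner_integral_diff
        has_bochner_integral_divide_zero has_bochner_integral_mult_right x_sq z_sq y_sq D_int) auto
  then have L_int: "has_bochner_integral G L
      (\<Sum>i<m. (((\<integral>x. (e x i)\<^sup>2 \<partial>gaussian_vec m \<sigma>) + 1) / (2 * c)
        + c / (2 * \<sigma>\<^sup>2) * (\<integral>(x, z). (x i - g (y x z) i)\<^sup>2 \<partial>G) - \<sigma>\<^sup>2 / (2 * \<sigma>\<^sup>2) - 1 / 2))"
    by (simp add: L_def case_prod_beta')
  \<comment> \<open>Host and noise contribute 1/2 each per coordinate, which adds up to the term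
    \<open>- m\<close>.\<close>
  also have "(\<Sum>i<m. (((\<integral>x. (e x i)\<^sup>2 \<partial>gaussian_vec m \<sigma>) + 1) / (2 * c)
        + c / (2 * \<sigma>\<^sup>2) * (\<integral>(x, z). (x i - g (y x z) i)\<^sup>2 \<partial>G) - \<sigma>\<^sup>2 / (2 * \<sigma>\<^sup>2) - 1 / 2))
      = ((\<Sum>i<m. \<integral>x. (e x i)\<^sup>2 \<partial>gaussian_vec m \<sigma>) + m) / (2 * c) + c / (2 * \<sigma>\<^sup>2) * D - m"
    using \<sigma> by (simp add: D_def sum.distrib sum_subtractf sum_distrib_left sum_divide_distrib[symmetric])
  finally have L_int: "has_bochner_integral G L \<dots>" .

  text \<open>\<open>exp (- L)\<close> is the likelihood ratio of the comparison law and the true law, so \<open>E L \<ge> 0\<close>.\<close>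
  let ?a = "sqrt c" and ?b = "\<sigma> / sqrt c"
  have c: "c > 0" using Q by (simp add: c_def)
  have ratio: "gauss_density m ?a (y x z) * gauss_density m ?b (vec_diff m x (g (y x z)))
      / (gauss_density m \<sigma> x * gauss_density m 1 z) = exp (- L (x, z))" for x z
  proof -
    define r where "r = sqrt (2 * pi)"
    have r: "r > 0" by (simp add: r_def)
    \<comment> \<open>The product of the standard deviations \<open>?a\<close> and \<open>?b\<close>
      is \<open>\<sigma>\<close>, the same as for host and unit noise.\<close>
    have norm: "(sqrt c * r) ^ m * (\<sigma> / sqrt c * r) ^ m = (\<sigma> * r) ^ m * (1 * r) ^ m"
      unfolding power_mult_distrib[symmetric] using c by (simp add: mult_ac)
    have "gauss_density m ?a (y x z) * gauss_density m ?b (vec_diff m x (g (y x z)))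
        / (gauss_density m \<sigma> x * gauss_density m 1 z)
      = (exp (- (\<Sum>i<m. (y x z i)\<^sup>2) / (2 * c)) * exp (- (\<Sum>i<m. (x i - g (y x z) i)\<^sup>2) / (2 * (\<sigma>\<^sup>2 / c)))
          / ((sqrt c * r) ^ m * (\<sigma> / sqrt c * r) ^ m))
        / (exp (- (\<Sum>i<m. (x i)\<^sup>2) / (2 * \<sigma>\<^sup>2)) * exp (- (\<Sum>i<m. (z i)\<^sup>2) / 2)
          / ((\<sigma> * r) ^ m * (1 * r) ^ m))"
      using c \<sigma> by (simp add: gauss_density_altdef vec_diff_def power_divide r_def)
    also have "\<dots> = exp (- (\<Sum>i<m. (y x z i)\<^sup>2) / (2 * c)) * exp (- (\<Sum>i<m. (x i - g (y x z) i)\<^sup>2) / (2 * (\<sigma>\<^sup>2 / c)))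
        / (exp (- (\<Sum>i<m. (x i)\<^sup>2) / (2 * \<sigma>\<^sup>2)) * exp (- (\<Sum>i<m. (z i)\<^sup>2) / 2))"
      unfolding norm using \<sigma> r by simp
    also have "\<dots> = exp (- L (x, z))"
      unfolding exp_add[symmetric] exp_diff[symmetric]
      using c \<sigma> by (simp add: L_def sum.distrib sum_subtractf sum_distrib_left[symmetric]
          sum_divide_distrib[symmetric])
    finally show ?thesis .
  qed
  have exp_L: "(\<integral>\<^sup>+p. ennreal (exp (- L p)) \<partial>G) = 1"
    using nn_integral_gaussian_change_of_measure[OF \<sigma> _ _ e g, of ?a ?b] c \<sigma>
    by (simp add: G_def y_def[symmetric] ratio case_prod_beta')
  have [measurable]: "L \<in> borel_measurable G" using L_int by (rule borel_measurable_has_bochner_integral)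
  have "has_bochner_integral G (\<lambda>p. exp (- L p)) 1"
    by (rule has_bochner_integral_nn_integral) (use exp_L in auto)
  moreover have "has_bochner_integral G (\<lambda>p. 1 - L p)
      (1 - (((\<Sum>i<m. \<integral>x. (e x i)\<^sup>2 \<partial>gaussian_vec m \<sigma>) + m) / (2 * c) + c / (2 * \<sigma>\<^sup>2) * D - m))"
    using pairI[OF one] by (intro has_bochner_integral_diff L_int) (simp add: case_prod_beta')
  \<comment> \<open>Integrating this tangent bound gives Gibbs' inequality without forming a
    relative entropy: \<open>1 - E L\<close> is at most the total mass 1.\<close>
  moreover have "1 - L p \<le> exp (- L p)" for p
    using exp_ge_add_one_self[of "- L p"] by simp
  ultimately have "1 - (((\<Sum>i<m. \<integral>x. (e x i)\<^sup>2 \<partial>gaussian_vec m \<sigma>) + m) / (2 * c) + c / (2 * \<sigma>\<^sup>2) * D - m) \<le> 1"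
    using integral_mono[of G "\<lambda>p. 1 - L p" "\<lambda>p. exp (- L p)"] by (simp add: has_bochner_integral_iff)
  moreover have "((\<Sum>i<m. \<integral>x. (e x i)\<^sup>2 \<partial>gaussian_vec m \<sigma>) + m) / (2 * c) \<le> m / 2"
  proof -
    have "(\<Sum>i<m. \<integral>x. (e x i)\<^sup>2 \<partial>gaussian_vec m \<sigma>) + m \<le> m * c"
      using eQ by (simp add: c_def distrib_left)
    then show ?thesis using c by (simp add: divide_le_eq)
  qed
  ultimately have "m / 2 \<le> c / (2 * \<sigma>\<^sup>2) * D" by linarith
  then have "m * \<sigma>\<^sup>2 / c \<le> D" using c \<sigma> by (simp add: field_simps)
  then show ?thesis by (simp add: D_def c_def y_def G_def)
qed

section \<open>The bound at a fixed blocklength\<close>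

text \<open>Each summand is dominated by the sum. This turns a finite power or distortion in
  \<open>ennreal\<close> into real second moments of the coordinates.\<close>

lemma nn_integral_sum_nonneg_finite:
  fixes f :: "'i \<Rightarrow> 'a \<Rightarrow> real"
  assumes "finite I" and [measurable]: "\<And>i. i \<in> I \<Longrightarrow> f i \<in> borel_measurable M"
    and nonneg: "\<And>i x. i \<in> I \<Longrightarrow> 0 \<le> f i x"
    and fin: "(\<integral>\<^sup>+x. ennreal (\<Sum>i\<in>I. f i x) \<partial>M) < \<infinity>"
  shows "i \<in> I \<Longrightarrow> integrable M (f i)"
    and "(\<integral>\<^sup>+x. ennreal (\<Sum>i\<in>I. f i x) \<partial>M) = ennreal (\<Sum>i\<in>I. \<integral>x. f i x \<partial>M)"
proof -
  show int: "integrable M (f i)" if "i \<in> I" for i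
  proof (rule integrableI_nonneg)
    have "(\<integral>\<^sup>+x. ennreal (f i x) \<partial>M) \<le> (\<integral>\<^sup>+x. ennreal (\<Sum>i\<in>I. f i x) \<partial>M)"
      using that assms(1) nonneg by (intro nn_integral_mono ennreal_leI member_le_sum) auto
    then show "(\<integral>\<^sup>+x. ennreal (f i x) \<partial>M) < \<infinity>" using fin by (rule le_less_trans)
  qed (use that nonneg in auto)
  have "(\<integral>\<^sup>+x. ennreal (\<Sum>i\<in>I. f i x) \<partial>M) = ennreal (\<integral>x. (\<Sum>i\<in>I. f i x) \<partial>M)"
    using int nonneg by (intro nn_integral_eq_integral) (auto intro!: sum_nonneg)
  then show "(\<integral>\<^sup>+x. ennreal (\<Sum>i\<in>I. f i x) \<partial>M) = ennreal (\<Sum>i\<in>I. \<integral>x. f i x \<partial>M)"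
    using int by simp
qed

text \<open>The correlation \<open>s\<close> achieved by the code is one candidate in the infimum,
  so it suffices to bound the distortion for this \<open>s\<close> and every
  \<open>\<gamma>\<close>.\<close>

lemma lower_bound_le_expected_distortion:
  assumes \<sigma>: "0 < \<sigma>" and P: "0 \<le> P" and m: "1 \<le> m" and code: "admissible_code \<sigma> P m enc dec"
  shows "lower_bound \<sigma> P \<le> expected_distortion \<sigma> m enc dec"
proof (cases "expected_distortion \<sigma> m enc dec = \<infinity>")
  case finite_distortion: False
  interpret X: prob_space "gaussian_vec m \<sigma>" by (rule prob_space_gaussian_vec[OF \<sigma>])
  interpret Z: prob_space "gaussian_vec m 1" by (rule prob_space_gaussian_vec) simp
  have enc [measurable]: "enc \<in> vec_borel m \<rightarrow>\<^sub>M vec_borel m"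
    and dec [measurable]: "dec \<in> vec_borel m \<rightarrow>\<^sub>M vec_borel m"
    and power: "(\<integral>\<^sup>+x. ennreal (\<Sum>i<m. (x i - enc x i)\<^sup>2) \<partial>gaussian_vec m \<sigma>) \<le> ennreal (real m * P)"
    using code by (simp_all add: admissible_code_def power_constraint_def sq_dist_def)
  define G where "G = gaussian_vec m \<sigma> \<Otimes>\<^sub>M gaussian_vec m 1"
  define y where "y p = vec_add m (enc (fst p)) (snd p)" for p
  have sets_G [measurable_cong]: "sets G = sets (vec_borel m \<Otimes>\<^sub>M vec_borel m)"
    unfolding G_def by (intro sets_pair_measure_cong sets_gaussian_vec)
  have y_meas [measurable]: "y \<in> G \<rightarrow>\<^sub>M vec_borel m"
    unfolding y_def by measurable
  have comp [measurable (raw)]: "(\<lambda>w. f w i) \<in> borel_measurable N"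
    if "f \<in> N \<rightarrow>\<^sub>M vec_borel m" "i < m" for f i and N :: "'b measure"
    using that by (intro measurable_compose[OF that(1) measurable_component_singleton]) simp
  have comps: "(\<lambda>x. x i) \<in> borel_measurable (gaussian_vec m \<sigma>)"
      "(\<lambda>x. x i - enc x i) \<in> borel_measurable (gaussian_vec m \<sigma>)"
      "(\<lambda>p. enc (fst p) i - dec (y p) i) \<in> borel_measurable G" if "i < m" for i
    using that by measurable

  have power_lt: "(\<integral>\<^sup>+x. ennreal (\<Sum>i<m. (x i - enc x i)\<^sup>2) \<partial>gaussian_vec m \<sigma>) < \<infinity>"
    using power by (rule le_less_trans) simp
  note power_sum = nn_integral_sum_nonneg_finite[of "{..<m}" "\<lambda>i x. (x i - enc x i)\<^sup>2", OF _ _ _ power_lt]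
  have v2: "integrable (gaussian_vec m \<sigma>) (\<lambda>x. (x i - enc x i)\<^sup>2)" if "i < m" for i
    by (rule power_sum(1)) (use comps that in auto)
  have x2: "integrable (gaussian_vec m \<sigma>) (\<lambda>x. (x i)\<^sup>2)"
      "(\<integral>x. (x i)\<^sup>2 \<partial>gaussian_vec m \<sigma>) = \<sigma>\<^sup>2" if "i < m" for i
    using gaussian_vec_moments(2)[OF \<sigma> that] by (auto simp: has_bochner_integral_iff)
  define R where "R = (\<Sum>i<m. \<integral>x. (x i - enc x i)\<^sup>2 \<partial>gaussian_vec m \<sigma>)"
  define T where "T = (\<Sum>i<m. \<integral>x. x i * (x i - enc x i) \<partial>gaussian_vec m \<sigma>)"
  have "ennreal R \<le> ennreal (real m * P)"
    using power power_sum(2) comps by (simp add: R_def)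
  then have R: "R \<le> m * P" using P by (simp add: ennreal_le_iff)
  have lincomb: "integrable (gaussian_vec m \<sigma>) (\<lambda>x. (a * x i + b * (x i - enc x i))\<^sup>2)" if "i < m" for a b i
    using that by (intro integrable_square_lincomb(1) comps x2(1) v2)
  have lincomb_sum: "(\<Sum>i<m. \<integral>x. (a * x i + b * (x i - enc x i))\<^sup>2 \<partial>gaussian_vec m \<sigma>)
      = a\<^sup>2 * (m * \<sigma>\<^sup>2) + 2 * a * b * T + b\<^sup>2 * R" for a b
  proof -
    have "(\<Sum>i<m. \<integral>x. (a * x i + b * (x i - enc x i))\<^sup>2 \<partial>gaussian_vec m \<sigma>)
      = (\<Sum>i<m. a\<^sup>2 * \<sigma>\<^sup>2 + 2 * a * b * (\<integral>x. x i * (x i - enc x i) \<partial>gaussian_vec m \<sigma>)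
          + b\<^sup>2 * (\<integral>x. (x i - enc x i)\<^sup>2 \<partial>gaussian_vec m \<sigma>))"
      by (intro sum.cong refl, subst integrable_square_lincomb(2)) (use comps x2 v2 in auto)
    then show ?thesis by (simp add: sum.distrib sum_distrib_left R_def T_def)
  qed

  \<comment> \<open>Since \<open>x i - enc x i\<close> is the negative of the input
    \<open>V\<close>, the sign makes \<open>s\<close> the averaged covariance of host and
    input.\<close>
  define s where "s = - T / m"
  \<comment> \<open>Formed with the permitted power \<open>P\<close> instead of the power
    \<open>R / m\<close> actually spent, so that \<open>1 + Q\<close> is the denominator in the
    bound.\<close>
  define Q where "Q = \<sigma>\<^sup>2 + P + 2 * s"
  have T_eq: "T = - (m * s)" using m by (simp add: s_def)
  \<comment> \<open>Cauchy-Schwarz places \<open>s\<close> in the range of the infimum.\<close>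
  have "T\<^sup>2 \<le> (\<Sum>i<m. \<integral>x. (x i)\<^sup>2 \<partial>gaussian_vec m \<sigma>) * R"
    unfolding T_def R_def by (rule sum_integral_Cauchy_Schwarz) (use comps x2 v2 in auto)
  also have "\<dots> \<le> (m * \<sigma>\<^sup>2) * (m * P)"
    using R by (simp add: x2 mult_left_mono)
  finally have "m\<^sup>2 * s\<^sup>2 \<le> m\<^sup>2 * (\<sigma> * sqrt P)\<^sup>2"
    using P by (simp add: T_eq power_mult_distrib) (simp add: power2_eq_square mult_ac)
  then have "s\<^sup>2 \<le> (\<sigma> * sqrt P)\<^sup>2" using m by simp
  then have s_abs: "\<bar>s\<bar> \<le> \<sigma> * sqrt P" using \<sigma> P by (simp add: abs_le_square_iff[symmetric])
  have "0 \<le> (\<sigma> - sqrt P)\<^sup>2" by simp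
  also have "\<dots> \<le> Q" using s_abs P by (simp add: power2_diff Q_def)
  finally have Q: "0 < 1 + Q" by simp

  have pair_lift: "has_bochner_integral G (\<lambda>p. f (fst p)) (\<integral>x. f x \<partial>gaussian_vec m \<sigma>)"
    if "integrable (gaussian_vec m \<sigma>) f" for f :: "(nat \<Rightarrow> real) \<Rightarrow> real"
    using has_bochner_integral_pair_mult[OF X.sigma_finite_measure_axioms Z.sigma_finite_measure_axioms
        has_bochner_integral_integrable[OF that], of "\<lambda>_. 1" 1]
    by (simp add: G_def case_prod_beta' has_bochner_integral_iff Z.prob_space)

  have dist_eq: "expected_distortion \<sigma> m enc dec
      = (\<integral>\<^sup>+p. ennreal (\<Sum>i<m. (enc (fst p) i - dec (y p) i)\<^sup>2 / m) \<partial>G)"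
    by (simp add: expected_distortion_def distortion_def sq_dist_def G_def y_def case_prod_beta'
        sum_divide_distrib)
  define D where "D = (\<Sum>i<m. \<integral>p. (enc (fst p) i - dec (y p) i)\<^sup>2 \<partial>G)"
  have dist_lt: "(\<integral>\<^sup>+p. ennreal (\<Sum>i<m. (enc (fst p) i - dec (y p) i)\<^sup>2 / m) \<partial>G) < \<infinity>"
    using finite_distortion unfolding dist_eq by (simp add: less_top)
  note dist_sum = nn_integral_sum_nonneg_finite[of "{..<m}"
      "\<lambda>i p. (enc (fst p) i - dec (y p) i)\<^sup>2 / m", OF _ _ _ dist_lt]
  have w2: "integrable G (\<lambda>p. (enc (fst p) i - dec (y p) i)\<^sup>2)" if "i < m" for i
  proof -
    have "integrable G (\<lambda>p. (enc (fst p) i - dec (y p) i)\<^sup>2 / m)"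
      by (rule dist_sum(1)) (use comps that in auto)
    then show ?thesis using m integrable_mult_right[of m G "\<lambda>p. (enc (fst p) i - dec (y p) i)\<^sup>2 / m"] by simp
  qed
  have dist_D: "expected_distortion \<sigma> m enc dec = ennreal (D / m)"
    unfolding dist_eq using dist_sum(2) comps by (simp add: D_def sum_divide_distrib)

  \<comment> \<open>Stated before the division by \<open>\<gamma>\<close>.\<close>
  have D_bound: "sqrt (\<sigma>\<^sup>2 / (1 + Q)) - sqrt ((1 - \<gamma>)\<^sup>2 * \<sigma>\<^sup>2 + \<gamma>\<^sup>2 * P - 2 * \<gamma> * (1 - \<gamma>) * s)
      \<le> \<bar>\<gamma>\<bar> * sqrt (D / m)" for \<gamma>
  proof -
    define A where "A = (1 - \<gamma>)\<^sup>2 * \<sigma>\<^sup>2 + \<gamma>\<^sup>2 * P - 2 * \<gamma> * (1 - \<gamma>) * s"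
    \<comment> \<open>This is \<open>X0 - \<gamma> X1\<close>, written in host and input so that
      \<open>lincomb_sum\<close> gives its energy; \<open>W\<close> is \<open>\<gamma>\<close> times
      the decoding error.\<close>
    define U where "U i p = (1 - \<gamma>) * fst p i + \<gamma> * (fst p i - enc (fst p) i)" for i and p :: "(nat \<Rightarrow> real) \<times> (nat \<Rightarrow> real)"
    define W where "W i p = \<gamma> * (enc (fst p) i - dec (y p) i)" for i p
    define g where "g u = (\<lambda>i\<in>{..<m}. \<gamma> * dec u i)" for u
    have g [measurable]: "g \<in> vec_borel m \<rightarrow>\<^sub>M vec_borel m"
      unfolding g_def by (intro measurable_restrict) measurable
    have UW: "fst p i - g (y p) i = U i p + W i p" if "i < m" for i p
      using that by (simp add: U_def W_def g_def algebra_simps)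
    have U: "has_bochner_integral G (\<lambda>p. (U i p)\<^sup>2)
        (\<integral>x. ((1 - \<gamma>) * x i + \<gamma> * (x i - enc x i))\<^sup>2 \<partial>gaussian_vec m \<sigma>)" if "i < m" for i
      unfolding U_def by (rule pair_lift[OF lincomb[OF that]])
    have W: "integrable G (\<lambda>p. (W i p)\<^sup>2)" if "i < m" for i
      using w2[OF that] by (simp add: W_def power_mult_distrib)
    have U_meas: "U i \<in> borel_measurable G" and W_meas: "W i \<in> borel_measurable G" if "i < m" for i
      unfolding U_def W_def using that by measurable
    have UW_int: "integrable G (\<lambda>p. (fst p i - g (y p) i)\<^sup>2)" if "i < m" for i
      using integrable_square_lincomb(1)[of "U i" G "W i" 1 1] U W U_meas W_meas that
      by (simp add: UW has_bochner_integral_iff)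

    have "real m * \<sigma>\<^sup>2 / (1 + Q) \<le> (\<Sum>i<m. \<integral>p. (fst p i - g (y p) i)\<^sup>2 \<partial>G)"
    proof -
      have "(\<Sum>i<m. \<integral>x. (enc x i)\<^sup>2 \<partial>gaussian_vec m \<sigma>) \<le> real m * Q"
        \<comment> \<open>The coefficients 1 and -1 recover \<open>enc x i\<close> from
          \<open>x i\<close> and \<open>x i - enc x i\<close>.\<close>
        using lincomb_sum[of 1 "-1"] R by (simp add: T_eq Q_def algebra_simps)
      moreover have "integrable (gaussian_vec m \<sigma>) (\<lambda>x. (enc x i)\<^sup>2)" if "i < m" for i
        using lincomb[OF that, of 1 "-1"] by simp
      ultimately show ?thesis
        using gaussian_estimation_lower_bound[OF \<sigma> Q enc g] UW_int
        by (simp add: G_def y_def case_prod_beta')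
    qed
    then have "sqrt (real m * (\<sigma>\<^sup>2 / (1 + Q))) \<le> sqrt (\<Sum>i<m. \<integral>p. (U i p + W i p)\<^sup>2 \<partial>G)"
      by (simp add: UW)
    also have "\<dots> \<le> sqrt (\<Sum>i<m. \<integral>p. (U i p)\<^sup>2 \<partial>G) + sqrt (\<Sum>i<m. \<integral>p. (W i p)\<^sup>2 \<partial>G)"
      by (rule sum_integral_Minkowski) (use U W U_meas W_meas in \<open>auto simp: has_bochner_integral_iff\<close>)
    also have "(\<Sum>i<m. \<integral>p. (U i p)\<^sup>2 \<partial>G) = (1 - \<gamma>)\<^sup>2 * (m * \<sigma>\<^sup>2) + 2 * (1 - \<gamma>) * \<gamma> * T + \<gamma>\<^sup>2 * R"
      unfolding lincomb_sum[symmetric] using U by (intro sum.cong) (auto simp: has_bochner_integral_iff)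
    \<comment> \<open>Unspent power does no harm: \<open>R\<close> occurs with the nonnegative
      factor \<open>\<gamma>\<^sup>2\<close>, so replacing it by \<open>m * P\<close> only enlarges
      the right-hand side.\<close>
    also have "sqrt \<dots> \<le> sqrt (m * A)"
      using mult_left_mono[OF R, of "\<gamma>\<^sup>2"] by (simp add: T_eq A_def algebra_simps)
    also have "(\<Sum>i<m. \<integral>p. (W i p)\<^sup>2 \<partial>G) = \<gamma>\<^sup>2 * (m * (D / m))"
      using m by (simp add: W_def power_mult_distrib D_def sum_distrib_left[symmetric])
    finally have "sqrt m * sqrt (\<sigma>\<^sup>2 / (1 + Q)) \<le> sqrt m * (sqrt A + \<bar>\<gamma>\<bar> * sqrt (D / m))"
      unfolding real_sqrt_mult by (simp add: distrib_left mult_ac)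
    then show ?thesis using m by (simp add: A_def)
  qed

  have "lower_bound \<sigma> P \<le> ennreal (D / m)"
    unfolding lower_bound_def
  proof (rule INF_lower2[of s], use s_abs in force, rule SUP_least)
    fix \<gamma> :: real assume "\<gamma> \<in> UNIV - {0}"
    then have \<gamma>: "\<gamma>\<^sup>2 > 0" by simp
    have D: "0 \<le> D / m" by (auto simp: D_def intro!: divide_nonneg_nonneg sum_nonneg)
    let ?B = "sqrt (\<sigma>\<^sup>2 / (1 + \<sigma>\<^sup>2 + P + 2 * s))
      - sqrt ((1 - \<gamma>)\<^sup>2 * \<sigma>\<^sup>2 + \<gamma>\<^sup>2 * P - 2 * \<gamma> * (1 - \<gamma>) * s)"
    \<comment> \<open>The right-hand side is nonnegative, so the positive part may be taken, and
      then squaring preserves the inequality.\<close>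
    have "max ?B 0 \<le> \<bar>\<gamma>\<bar> * sqrt (D / m)"
      using D_bound[of \<gamma>] D by (simp add: Q_def add.assoc)
    then have "(max ?B 0)\<^sup>2 \<le> (\<bar>\<gamma>\<bar> * sqrt (D / m))\<^sup>2" by (intro power_mono) auto
    also have "\<dots> = \<gamma>\<^sup>2 * (D / m)" using D by (simp add: power_mult_distrib del: times_divide_eq_right)
    finally show "ennreal (1 / \<gamma>\<^sup>2 * (max ?B 0)\<^sup>2) \<le> ennreal (D / m)"
      using \<gamma> by (intro ennreal_leI) (simp add: field_simps)
  qed
  then show ?thesis by (simp add: dist_D)
qed simp

section \<open>Passage to the asymptotic bound\<close>

theorem corollary1:
  fixes \<sigma> P :: real
  assumes "\<sigma> > 0" and "P \<ge> 0"
  shows "MMSE0 \<sigma> P \<ge> lower_bound \<sigma> P \<and>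
    (\<forall>m\<ge>1. \<forall>enc dec. admissible_code \<sigma> P m enc dec \<longrightarrow>
       expected_distortion \<sigma> m enc dec \<ge> lower_bound \<sigma> P)"
proof (intro conjI allI impI)
  show "lower_bound \<sigma> P \<le> MMSE0 \<sigma> P"
    unfolding MMSE0_def
  proof (rule INF_greatest, clarify)
    fix enc dec :: "nat \<Rightarrow> (nat \<Rightarrow> real) \<Rightarrow> (nat \<Rightarrow> real)"
    assume codes: "\<forall>m\<ge>1. admissible_code \<sigma> P m (enc m) (dec m)"
    \<comment> \<open>Codes are constrained only for \<open>m \<ge> 1\<close>, and the distortion at
      \<open>m = 0\<close> is 0 by division by zero; the limit superior ignores this index.\<close>
    have "eventually (\<lambda>m. lower_bound \<sigma> P \<le> expected_distortion \<sigma> m (enc m) (dec m)) sequentially"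
      using eventually_ge_at_top[of 1]
      by eventually_elim (use assms codes lower_bound_le_expected_distortion in blast)
    then show "lower_bound \<sigma> P \<le> limsup (\<lambda>m. expected_distortion \<sigma> m (enc m) (dec m))"
      by (intro le_Limsup) auto
  qed
qed (use assms lower_bound_le_expected_distortion in blast)

end
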